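(* Let $A\in\mathbf{R}^{m\times n}$, $b\in\mathbf{R}^m$, let $k\ge 1$ be an integer, and let $p\in[1,\infty)$, $q\in[1,\infty]$ with $\frac1p+\frac1q=1$. Let $x^*\in\mathbf{R}^n$ be a $k$-sparse solution of $Ax=b$. If the generalized restricted isometry constant of $A$ satisfies $$0<\beta_{2k,p,q}<(2k)^{\min\{\frac1q-\frac1p,\,0\}},$$ then $x^*$ is the unique sparsest solution of $Ax=b$.
   Context: $\|x\|_0$ is the number of nonzero components of $x$; a vector $x$ is $k$-sparse if $\|x\|_0\le k$. $\|\cdot\|_p$ is the usual $\ell_p$ norm, and $1/\infty=0$. A sparsest solution of $Ax=b$ is a solution minimizing $\|x\|_0$ among all solutions. For an index set $S\subset\{1,\dots,n\}$, $A_S$ is the submatrix of $A$ formed by the columns indexed by $S$, and $\mathbf{I}_r$ is the $r\times r$ identity matrix. For a positive integer $r$ and $p\in[1,\infty)$, $q\in[1,\infty]$ with $\frac1p+\frac1q=1$, the $(r,p,q)$-generalized restricted isometry constant (gRIC) of $A$ is $$\beta_{r,p,q}=\sup_{S\subset\{1,\dots,n\},\,|S|\le r}\ \sup_{x\in\mathbf{R}^{|S|}\setminus\{0\}}\frac{\|(\mathbf{I}_{|S|}-A_S^TA_S)x\|_q}{\|x\|_p}.$$ *)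

theory Defs
  imports
    Complex_Main
    "HOL-Library.Extended_Nonnegative_Real"
    "Jordan_Normal_Form.DL_Submatrix"
begin

(* Index sets are 0-based: coordinates and columns are numbered 0, ..., n-1. *)

definition l0_norm :: "real vec \<Rightarrow> nat" where
  "l0_norm x = card {i. i < dim_vec x \<and> x $ i \<noteq> 0}"

definition sparse_vec :: "nat \<Rightarrow> real vec \<Rightarrow> bool" where
  "sparse_vec k x \<longleftrightarrow> l0_norm x \<le> k"

(* Meant for exponents 1 \<le> p \<le> \<infinity>. The inserted 0 makes the maximum well defined in dimension 0. *)
definition lp_norm :: "ereal \<Rightarrow> real vec \<Rightarrow> real" where
  "lp_norm p x =
     (if p = \<infinity> then Max (insert 0 ((\<lambda>i. \<bar>x $ i\<bar>) ` {..<dim_vec x}))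
      else (\<Sum>i<dim_vec x. \<bar>x $ i\<bar> powr real_of_ereal p) powr (1 / real_of_ereal p))"

definition column_submatrix :: "real mat \<Rightarrow> nat set \<Rightarrow> real mat" where
  "column_submatrix A S = submatrix A UNIV S"

(* The suprema are over sets of nonnegative reals and are taken in ennreal, so that the empty
   supremum (for S = {}, where there is no nonzero x) is 0. *)
definition gRIC :: "real mat \<Rightarrow> nat \<Rightarrow> real \<Rightarrow> ereal \<Rightarrow> ennreal" where
  "gRIC A r p q =
     (SUP S \<in> {S. S \<subseteq> {..<dim_col A} \<and> card S \<le> r}.
      SUP x \<in> carrier_vec (card S) - {0\<^sub>v (card S)}.
        ennreal
          (lp_norm q
             ((1\<^sub>m (card S) - transpose_mat (column_submatrix A S) * column_submatrix A S) *\<^sub>v x)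
           / lp_norm (ereal p) x))"

definition solutions :: "real mat \<Rightarrow> real vec \<Rightarrow> real vec set" where
  "solutions A b = {x \<in> carrier_vec (dim_col A). A *\<^sub>v x = b}"

definition sparsest_solution :: "real mat \<Rightarrow> real vec \<Rightarrow> real vec \<Rightarrow> bool" where
  "sparsest_solution A b x \<longleftrightarrow>
     x \<in> solutions A b \<and> (\<forall>y \<in> solutions A b. l0_norm x \<le> l0_norm y)"

end

theory Submission
  imports Defs "HOL-Analysis.Convex"
begin

text \<open>
  Two \<open>k\<close>-sparse solutions of \<open>A x = b\<close> differ by a \<open>2k\<close>-sparse vector \<open>h\<close> in the kernel of \<open>A\<close>.
  If \<open>h\<close> were nonzero with support \<open>S\<close>, its restriction \<open>x\<close> to \<open>S\<close> would be a nonzero vector with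
  \<open>A\<^sub>S x = 0\<close>, hence a fixed vector of \<open>I - A\<^sub>S\<^sup>T A\<^sub>S\<close>; the quotient defining the isometry constant
  would then take the value \<open>\<parallel>x\<parallel>\<^sub>q / \<parallel>x\<parallel>\<^sub>p\<close> at \<open>x\<close>. Comparing norms on a space of dimension at most
  \<open>2k\<close> shows that this value is at least \<open>(2k)\<close> to the power \<open>min (1/q - 1/p) 0\<close>, which the bound
  on the constant excludes (lemma \<open>gRIC_kernel_lower_bound\<close>). So there is at
  most one \<open>k\<close>-sparse solution, and a solution with no more nonzero entries than \<open>xstar\<close> is
  \<open>k\<close>-sparse as well, hence equal to \<open>xstar\<close>.

  The norm comparison (lemma \<open>lp_norm_comparison\<close>) joins two facts: the \<open>\<ell>\<^sub>p\<close> norms decrease in the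
  exponent, which gives the value \<open>0\<close> of the minimum when \<open>q \<le> p\<close>, and the power means increase in
  the exponent, which gives \<open>1/q - 1/p\<close> when \<open>p < q\<close>. For \<open>q = \<infinity>\<close> it
  suffices to bound every entry by the largest one.
\<close>

section \<open>Comparison of the norms\<close>

text \<open>
  Monotonicity of power means. Young's inequality with weights \<open>p/q\<close> and \<open>1 - p/q\<close> compares each
  \<open>(f i) powr q\<close> with the mean \<open>M\<close> of all of them; summing over \<open>i\<close> makes the right-hand side
  collapse to \<open>card I * M\<close>.
\<close>

lemma sum_powr_le_card_powr:
  fixes f :: "'a \<Rightarrow> real"
  assumes "finite I" "\<And>i. i \<in> I \<Longrightarrow> 0 \<le> f i" "0 < p" "p \<le> q"
  shows "(\<Sum>i\<in>I. f i powr p) \<le> real (card I) powr (1 - p / q) * (\<Sum>i\<in>I. f i powr q) powr (p / q)"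
proof (cases "(\<Sum>i\<in>I. f i powr q) = 0")
  case True
  then have "f i = 0" if "i \<in> I" for i
    using sum_nonneg_eq_0_iff[of I "\<lambda>i. f i powr q"] assms(1) that by auto
  then show ?thesis by simp
next
  case False
  define c where "c = real (card I)"
  define t where "t = p / q"
  define M where "M = (\<Sum>i\<in>I. f i powr q) / c"
  have c: "c > 0"
    using False assms(1) by (auto simp: c_def card_gt_0_iff)
  have sum_pos: "(\<Sum>i\<in>I. f i powr q) > 0"
    using False by (simp add: order_less_le sum_nonneg)
  have M: "M > 0"
    using c sum_pos by (simp add: M_def)
  have t: "0 < t" "t \<le> 1" "q * t = p"
    using assms(3,4) by (auto simp: t_def)
  have "f i powr p * M powr (1 - t) \<le> t * f i powr q + (1 - t) * M" if "i \<in> I" for i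
  proof (cases "f i = 0")
    case True
    then show ?thesis using t M by simp
  next
    case False
    then have "f i powr q > 0" by simp
    then show ?thesis
      using Youngs_inequality_0[of t "1 - t" "f i powr q" M] t M by (simp add: powr_powr)
  qed
  then have "(\<Sum>i\<in>I. f i powr p * M powr (1 - t)) \<le> (\<Sum>i\<in>I. t * f i powr q + (1 - t) * M)"
    by (rule sum_mono)
  also have "\<dots> = t * (c * M) + c * ((1 - t) * M)"
    using c by (simp add: sum.distrib sum_distrib_left[symmetric] c_def M_def)
  also have "\<dots> = c * M"
    by (simp add: algebra_simps)
  also have "\<dots> = (c * M powr t) * M powr (1 - t)"
    using M by (simp add: powr_add[symmetric] mult.assoc)
  finally have "(\<Sum>i\<in>I. f i powr p) * M powr (1 - t) \<le> (c * M powr t) * M powr (1 - t)"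
    by (simp add: sum_distrib_right)
  then have "(\<Sum>i\<in>I. f i powr p) \<le> c * M powr t"
    using M by simp
  also have "\<dots> = c powr (1 - t) * (\<Sum>i\<in>I. f i powr q) powr t"
    using c sum_pos by (simp add: M_def powr_divide powr_diff)
  finally show ?thesis
    by (simp add: c_def t_def)
qed

text \<open>
  Divided by the right-hand side \<open>N\<close>, every entry lies in \<open>[0, 1]\<close>, where a larger exponent gives
  a smaller power. Keeping the factor \<open>N\<close> in place of the division covers \<open>N = 0\<close> as well.
\<close>

lemma sum_powr_root_antimono:
  fixes f :: "'a \<Rightarrow> real"
  assumes "finite I" "\<And>i. i \<in> I \<Longrightarrow> 0 \<le> f i" "0 < q" "q \<le> p"
  shows "(\<Sum>i\<in>I. f i powr p) powr (1 / p) \<le> (\<Sum>i\<in>I. f i powr q) powr (1 / q)"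
proof -
  define N where "N = (\<Sum>i\<in>I. f i powr q) powr (1 / q)"
  have N0: "N \<ge> 0" by (simp add: N_def)
  have Nq: "N powr q = (\<Sum>i\<in>I. f i powr q)"
    using assms(3) by (simp add: N_def powr_powr sum_nonneg)
  have le: "f i \<le> N" if "i \<in> I" for i
  proof -
    have "f i powr q \<le> N powr q"
      unfolding Nq using assms(1) that by (intro member_le_sum) auto
    then show ?thesis
      using powr_less_mono2[of q N "f i"] N0 assms(3) by linarith
  qed
  have "f i powr p \<le> f i powr q * N powr (p - q)" if "i \<in> I" for i
  proof -
    have "f i powr p = f i powr q * f i powr (p - q)"
      by (simp add: powr_add[symmetric])
    also have "\<dots> \<le> f i powr q * N powr (p - q)"
      using le[OF that] assms(2)[OF that] assms(4) by (intro mult_left_mono powr_mono2) auto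
    finally show ?thesis .
  qed
  then have "(\<Sum>i\<in>I. f i powr p) \<le> (\<Sum>i\<in>I. f i powr q * N powr (p - q))"
    by (rule sum_mono)
  also have "\<dots> = N powr p"
    by (simp add: sum_distrib_right[symmetric] Nq[symmetric] powr_add[symmetric])
  finally have "(\<Sum>i\<in>I. f i powr p) powr (1 / p) \<le> (N powr p) powr (1 / p)"
    using assms(3,4) by (intro powr_mono2) (auto intro: sum_nonneg)
  also have "\<dots> = N"
    using assms(3,4) N0 by (simp add: powr_powr)
  finally show ?thesis by (simp add: N_def)
qed

lemma lp_norm_ereal:
  "lp_norm (ereal p) x = (\<Sum>i<dim_vec x. \<bar>x $ i\<bar> powr p) powr (1 / p)"
  by (simp add: lp_norm_def)

lemma lp_norm_infinity_upper: "i < dim_vec x \<Longrightarrow> \<bar>x $ i\<bar> \<le> lp_norm \<infinity> x"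
  by (simp add: lp_norm_def)

lemma lp_norm_infinity_nonneg: "0 \<le> lp_norm \<infinity> x"
  by (simp add: lp_norm_def)

lemma lp_norm_pos:
  assumes "x \<in> carrier_vec s" "x \<noteq> 0\<^sub>v s"
  shows "0 < lp_norm (ereal p) x"
proof -
  obtain i where i: "i < s" "x $ i \<noteq> 0"
    using assms by (metis carrier_vecD eq_vecI index_zero_vec(1) index_zero_vec(2))
  then have "0 < (\<Sum>i<dim_vec x. \<bar>x $ i\<bar> powr p)"
    using assms(1) by (intro sum_pos2[of _ i]) auto
  then show ?thesis by (simp add: lp_norm_ereal)
qed

text \<open>
  In dimension \<open>0\<close> both sides vanish, since \<open>0 powr a = 0\<close>. The conversion to \<open>real\<close> turns
  \<open>1 / \<infinity>\<close> into \<open>0\<close>.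
\<close>

lemma lp_norm_comparison:
  fixes q :: ereal
  assumes "0 < p" "0 < q"
  shows "real (dim_vec x) powr min (real_of_ereal (1 / q) - 1 / p) 0 * lp_norm (ereal p) x
           \<le> lp_norm q x"
proof -
  define s where "s = real (dim_vec x)"
  have s0: "s \<ge> 0" by (simp add: s_def)
  \<comment> \<open>For \<open>p < q\<close> the factor is moved to the other side, where its exponent is nonnegative.\<close>
  have move: "s powr (a - b) * lp_norm (ereal p) x \<le> N"
    if "lp_norm (ereal p) x \<le> s powr (b - a) * N" "0 \<le> N" for a b N
  proof (cases "s = 0")
    case False
    have "s powr (a - b) * lp_norm (ereal p) x \<le> s powr (a - b) * (s powr (b - a) * N)"
      using that(1) by (intro mult_left_mono) auto
    also have "\<dots> = N"
      using False s0 by (simp add: mult.assoc[symmetric] powr_add[symmetric])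
    finally show ?thesis .
  qed (use that in simp)
  show ?thesis
  proof (cases q)
    case PInf
    define N where "N = lp_norm \<infinity> x"
    have N0: "N \<ge> 0" by (simp add: N_def lp_norm_infinity_nonneg)
    have "(\<Sum>i<dim_vec x. \<bar>x $ i\<bar> powr p) \<le> (\<Sum>i<dim_vec x. N powr p)"
      using assms(1) by (intro sum_mono powr_mono2) (auto simp: N_def lp_norm_infinity_upper)
    then have "lp_norm (ereal p) x \<le> (s * N powr p) powr (1 / p)"
      unfolding lp_norm_ereal using assms(1)
      by (intro powr_mono2) (auto simp: s_def intro: sum_nonneg)
    also have "\<dots> = s powr (1 / p - 0) * N"
      using assms(1) N0 s0 by (simp add: powr_mult powr_powr)
    finally show ?thesis
      using move[of "1 / p" 0 N] N0 assms(1) PInf by (simp add: N_def s_def)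
  next
    case (real r)
    with assms have r: "0 < r" by simp
    show ?thesis
    proof (cases "r \<le> p")
      case True
      have "lp_norm (ereal p) x \<le> lp_norm q x"
        unfolding real lp_norm_ereal using True r by (intro sum_powr_root_antimono) auto
      moreover have "1 / p \<le> 1 / r"
        using True r by (intro frac_le) auto
      then have "min (real_of_ereal (1 / q) - 1 / p) 0 = 0"
        using r real by (simp add: one_ereal_def)
      moreover have "0 \<le> lp_norm q x"
        using real by (simp add: lp_norm_ereal)
      ultimately show ?thesis
        by auto
    next
      case False
      have "(\<Sum>i<dim_vec x. \<bar>x $ i\<bar> powr p)
              \<le> s powr (1 - p / r) * (\<Sum>i<dim_vec x. \<bar>x $ i\<bar> powr r) powr (p / r)"
        using sum_powr_le_card_powr[of "{..<dim_vec x}" "\<lambda>i. \<bar>x $ i\<bar>" p r] False assms(1)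
        by (simp add: s_def)
      then have "lp_norm (ereal p) x
          \<le> (s powr (1 - p / r) * (\<Sum>i<dim_vec x. \<bar>x $ i\<bar> powr r) powr (p / r)) powr (1 / p)"
        unfolding lp_norm_ereal using assms(1) by (intro powr_mono2) (auto intro: sum_nonneg)
      also have "\<dots> = s powr ((1 - p / r) * (1 / p)) * lp_norm q x"
        using assms(1) real by (simp add: powr_mult powr_powr lp_norm_ereal)
      also have "(1 - p / r) * (1 / p) = 1 / p - 1 / r"
        using assms(1) r by (simp add: field_simps)
      finally have "s powr (1 / r - 1 / p) * lp_norm (ereal p) x \<le> lp_norm q x"
        using real by (intro move) (auto simp: lp_norm_ereal)
      moreover have "1 / r \<le> 1 / p"
        using False assms(1) by (intro frac_le) auto
      then have "min (real_of_ereal (1 / q) - 1 / p) 0 = 1 / r - 1 / p"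
        using r real by (simp add: one_ereal_def)
      ultimately show ?thesis
        by (simp add: s_def)
    qed
  qed (use assms in auto)
qed

section \<open>Sparse kernel vectors\<close>

lemma bij_betw_pick:
  assumes "finite S"
  shows "bij_betw (pick S) {..<card S} S"
proof -
  have inj: "inj_on (pick S) {..<card S}"
    by (rule inj_onI) (metis lessThan_iff nat_neq_iff pick_mono_le)
  moreover have "pick S ` {..<card S} \<subseteq> S"
    by (auto intro: pick_in_set_le)
  ultimately have "pick S ` {..<card S} = S"
    using assms by (metis card_image card_lessThan card_subset_eq)
  with inj show ?thesis by (simp add: bij_betw_def)
qed

lemma column_submatrix_carrier:
  assumes "A \<in> carrier_mat m n" "S \<subseteq> {..<n}"
  shows "column_submatrix A S \<in> carrier_mat m (card S)"
proof -
  have "{j. j < n \<and> j \<in> S} = S" using assms(2) by auto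
  then show ?thesis
    using assms(1) unfolding column_submatrix_def by (intro carrier_matI) (auto simp: dim_submatrix)
qed

text \<open>Columns outside \<open>S\<close> meet only zero entries of \<open>h\<close>, so they contribute nothing to \<open>A h\<close>.\<close>

lemma column_submatrix_mult_restriction:
  assumes A: "A \<in> carrier_mat m n" and h: "h \<in> carrier_vec n" and S: "S \<subseteq> {..<n}"
    and supp: "\<And>i. i < n \<Longrightarrow> i \<notin> S \<Longrightarrow> h $ i = 0"
  shows "column_submatrix A S *\<^sub>v vec (card S) (\<lambda>j. h $ pick S j) = A *\<^sub>v h"
proof (rule eq_vecI)
  note B = column_submatrix_carrier[OF A S]
  have fin: "finite S" using S finite_subset by blast
  have SJ: "{j. j < n \<and> j \<in> S} = S" using S by auto
  show "dim_vec (column_submatrix A S *\<^sub>v vec (card S) (\<lambda>j. h $ pick S j)) = dim_vec (A *\<^sub>v h)"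
    using A B by auto
  fix i assume "i < dim_vec (A *\<^sub>v h)"
  then have i: "i < m" using A by auto
  have entry: "column_submatrix A S $$ (i, j) = A $$ (i, pick S j)" if "j < card S" for j
    unfolding column_submatrix_def using A SJ i that by (subst submatrix_index) (auto simp: pick_UNIV)
  have "(column_submatrix A S *\<^sub>v vec (card S) (\<lambda>j. h $ pick S j)) $ i
          = (\<Sum>j<card S. column_submatrix A S $$ (i, j) * h $ pick S j)"
    using B i by (auto simp: scalar_prod_def atLeast0LessThan intro!: sum.cong)
  also have "\<dots> = (\<Sum>j<card S. A $$ (i, pick S j) * h $ pick S j)"
    by (simp add: entry)
  also have "\<dots> = (\<Sum>l\<in>S. A $$ (i, l) * h $ l)"
    using sum.reindex_bij_betw[OF bij_betw_pick[OF fin], of "\<lambda>l. A $$ (i, l) * h $ l"] by simp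
  also have "\<dots> = (\<Sum>l<n. A $$ (i, l) * h $ l)"
    using S supp by (intro sum.mono_neutral_left) auto
  also have "\<dots> = (A *\<^sub>v h) $ i"
    using A h i by (auto simp: scalar_prod_def atLeast0LessThan intro!: sum.cong)
  finally show "(column_submatrix A S *\<^sub>v vec (card S) (\<lambda>j. h $ pick S j)) $ i = (A *\<^sub>v h) $ i" .
qed

text \<open>
  The reason why a small isometry constant forbids sparse kernel vectors: on the support \<open>S\<close> of
  \<open>h\<close> the matrix \<open>I - A\<^sub>S\<^sup>T A\<^sub>S\<close> fixes the restriction of \<open>h\<close>, so the constant is at least a ratio of
  two norms of one vector. The exponent is nonpositive, which allows the support size to be replaced
  by its bound \<open>r\<close>.
\<close>

lemma gRIC_kernel_lower_bound:
  fixes q :: ereal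
  assumes A: "A \<in> carrier_mat m n" and h: "h \<in> carrier_vec n" "h \<noteq> 0\<^sub>v n"
    and Ah: "A *\<^sub>v h = 0\<^sub>v m" and sparse: "l0_norm h \<le> r" and pq: "0 < p" "0 < q"
  shows "ennreal (real r powr min (real_of_ereal (1 / q) - 1 / p) 0) \<le> gRIC A r p q"
proof -
  define S where "S = {i. i < n \<and> h $ i \<noteq> 0}"
  define s where "s = card S"
  define x where "x = vec s (\<lambda>j. h $ pick S j)"
  define B where "B = column_submatrix A S"
  define e where "e = min (real_of_ereal (1 / q) - 1 / p) 0"
  have S: "S \<subseteq> {..<n}" by (auto simp: S_def)
  have fin: "finite S" using S finite_subset by blast
  have sr: "s \<le> r"
    using sparse h(1) by (simp add: s_def S_def l0_norm_def)
  have "S \<noteq> {}"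
    using h by (auto simp: S_def vec_eq_iff)
  then have s_pos: "0 < s"
    using fin by (simp add: s_def card_gt_0_iff)
  have x: "x \<in> carrier_vec s" by (simp add: x_def)
  have "x $ 0 \<noteq> 0"
    using s_pos pick_in_set_le[of 0 S] by (auto simp: x_def s_def S_def)
  then have x0: "x \<noteq> 0\<^sub>v s"
    using s_pos by auto
  have B: "B \<in> carrier_mat m s"
    unfolding B_def s_def by (rule column_submatrix_carrier[OF A S])
  have Bx: "B *\<^sub>v x = 0\<^sub>v m"
    unfolding B_def x_def s_def Ah[symmetric]
    by (rule column_submatrix_mult_restriction[OF A h(1) S]) (auto simp: S_def)
  have BTB: "transpose_mat B * B \<in> carrier_mat s s"
    using B by auto
  have "(1\<^sub>m s - transpose_mat B * B) *\<^sub>v x = 1\<^sub>m s *\<^sub>v x - (transpose_mat B * B) *\<^sub>v x"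
    using BTB x by (intro minus_mult_distrib_mat_vec) auto
  also have "(transpose_mat B * B) *\<^sub>v x = 0\<^sub>v s"
    using B x Bx by (subst assoc_mult_mat_vec[of _ s m _ s]) auto
  also have "1\<^sub>m s *\<^sub>v x - 0\<^sub>v s = x"
    using x by simp
  finally have fixed: "(1\<^sub>m s - transpose_mat B * B) *\<^sub>v x = x" .

  have "real r powr e * lp_norm (ereal p) x \<le> real s powr e * lp_norm (ereal p) x"
    using sr s_pos
    by (intro mult_right_mono powr_mono2') (auto simp: e_def lp_norm_ereal)
  also have "\<dots> \<le> lp_norm q x"
    using lp_norm_comparison[OF pq, of x] x by (simp add: e_def)
  finally have "real r powr e \<le> lp_norm q x / lp_norm (ereal p) x"
    using lp_norm_pos[OF x x0, of p] by (simp add: pos_le_divide_eq)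
  then have "ennreal (real r powr e)
      \<le> ennreal (lp_norm q ((1\<^sub>m (card S) - transpose_mat (column_submatrix A S) * column_submatrix A S) *\<^sub>v x)
                 / lp_norm (ereal p) x)"
    using fixed by (simp add: B_def s_def ennreal_leI)
  also have "\<dots> \<le> gRIC A r p q"
    unfolding gRIC_def
    by (rule SUP_upper2[of S], use S sr A in \<open>simp add: s_def\<close>, rule SUP_upper,
        use x x0 in \<open>simp add: s_def\<close>)
  finally show ?thesis by (simp add: e_def)
qed

lemma l0_norm_diff_le:
  assumes "x \<in> carrier_vec n" "y \<in> carrier_vec n"
  shows "l0_norm (x - y) \<le> l0_norm x + l0_norm y"
proof -
  have "{i. i < n \<and> (x - y) $ i \<noteq> 0} \<subseteq> {i. i < n \<and> x $ i \<noteq> 0} \<union> {i. i < n \<and> y $ i \<noteq> 0}"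
    using assms by auto
  then have "card {i. i < n \<and> (x - y) $ i \<noteq> 0}
      \<le> card ({i. i < n \<and> x $ i \<noteq> 0} \<union> {i. i < n \<and> y $ i \<noteq> 0})"
    by (intro card_mono) auto
  also have "\<dots> \<le> card {i. i < n \<and> x $ i \<noteq> 0} + card {i. i < n \<and> y $ i \<noteq> 0}"
    by (rule card_Un_le)
  finally show ?thesis
    using assms by (simp add: l0_norm_def)
qed

section \<open>Uniqueness of sparse solutions\<close>

lemma sparse_solution_unique:
  fixes q :: ereal
  assumes A: "A \<in> carrier_mat m n" and x: "x \<in> carrier_vec n" and y: "y \<in> carrier_vec n"
    and eq: "A *\<^sub>v x = A *\<^sub>v y" and sparse: "l0_norm x \<le> k" "l0_norm y \<le> k"
    and pq: "0 < p" "0 < q"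
    and small: "gRIC A (2 * k) p q < ennreal (real (2 * k) powr min (real_of_ereal (1 / q) - 1 / p) 0)"
  shows "x = y"
proof (rule ccontr)
  assume "x \<noteq> y"
  have "x - y \<noteq> 0\<^sub>v n"
  proof
    assume "x - y = 0\<^sub>v n"
    then have "(x - y) $ i = 0" if "i < n" for i using that by simp
    then have "x = y" using x y by (intro eq_vecI) auto
    with \<open>x \<noteq> y\<close> show False ..
  qed
  moreover have "A *\<^sub>v (x - y) = 0\<^sub>v m"
    using A x y eq by (simp add: mult_minus_distrib_mat_vec)
  moreover have "l0_norm (x - y) \<le> 2 * k"
    using l0_norm_diff_le[OF x y] sparse by linarith
  ultimately have "ennreal (real (2 * k) powr min (real_of_ereal (1 / q) - 1 / p) 0) \<le> gRIC A (2 * k) p q"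
    using x y pq by (intro gRIC_kernel_lower_bound[OF A]) auto
  with small show False by (simp add: not_le[symmetric])
qed

theorem theorem1:
  fixes A :: "real mat" and b xstar :: "real vec" and m n k :: nat and p :: real and q :: ereal
  assumes "A \<in> carrier_mat m n" and "b \<in> carrier_vec m"
    and "1 \<le> k"
    and "1 \<le> p" and "1 \<le> q" and "1 / ereal p + 1 / q = 1"
    and "xstar \<in> carrier_vec n" and "sparse_vec k xstar" and "A *\<^sub>v xstar = b"
    and "0 < gRIC A (2 * k) p q"
    and "gRIC A (2 * k) p q < ennreal (real (2 * k) powr min (real_of_ereal (1 / q) - 1 / p) 0)"
  shows "sparsest_solution A b xstar \<and> (\<forall>y. sparsest_solution A b y \<longrightarrow> y = xstar)"
proof -
  have pq: "0 < p" "0 < q"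
    using assms(4,5) less_le_trans[of 0 "1 :: ereal" q] by auto
  have unique: "y = xstar" if "y \<in> solutions A b" "l0_norm y \<le> l0_norm xstar" for y
  proof (rule sparse_solution_unique[OF assms(1) _ assms(7) _ _ _ pq assms(11)])
    show "y \<in> carrier_vec n" "A *\<^sub>v y = A *\<^sub>v xstar"
      using that(1) assms(1,9) by (auto simp: solutions_def)
    show "l0_norm y \<le> k" "l0_norm xstar \<le> k"
      using that(2) assms(8) by (auto simp: sparse_vec_def)
  qed
  have xstar: "xstar \<in> solutions A b"
    using assms(1,7,9) by (auto simp: solutions_def)
  have "sparsest_solution A b xstar"
    unfolding sparsest_solution_def using xstar unique by (metis nat_le_linear order_refl)
  moreover have "y = xstar" if "sparsest_solution A b y" for y
    using that xstar unique by (auto simp: sparsest_solution_def)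
  ultimately show ?thesis by blast
qed

end
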